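(* Let $(X,d)$ be a metric space and let $\mathfrak B$ be a bornology on $X$ with closed base such that $X\notin\mathfrak B$ and $X$ is $\mathfrak B^s$-Lindelöf. The following are equivalent: (1) the space $(\mathsf C(X),\tau_{\mathfrak B}^s)$ has countable strong fan tightness; (2) $X$ satisfies $\mathsf S_1(\mathcal O_{\mathfrak B^s},\mathcal O_{\mathfrak B^s})$.
   Context: A bornology on a metric space $(X,d)$ is a family $\mathfrak B$ of nonempty subsets of $X$ that is closed under finite unions, closed under taking nonempty subsets, and covers $X$. A base for $\mathfrak B$ is a subfamily $\mathfrak B_0\subset\mathfrak B$ such that every $B\in\mathfrak B$ is contained in some $B_0\in\mathfrak B_0$; it is a closed base if all its members are closed in $X$. For $A\subset X$ and $\varepsilon>0$, $A^{\varepsilon}=\bigcup_{a\in A}\{y\in X: d(a,y)<\varepsilon\}$. $\mathsf C(X)$ is the set of all continuous functions $X\to\mathbb R$. The topology $\tau_{\mathfrak B}^s$ of strong uniform convergence on $\mathfrak B$ is the topology on $\mathsf C(X)$ in which each $f$ has as a local base the sets $[B,\varepsilon]^s(f)=\{g\in\mathsf C(X):\exists\delta>0\ \forall x\in B^{\delta}\ |g(x)-f(x)|<\varepsilon\}$, for $B\in\mathfrak B$ and $\varepsilon>0$. A strong $\mathfrak B$-cover ($\mathfrak B^s$-cover) of $X$ is an open cover $\mathcal U$ of $X$ such that $X\notin\mathcal U$ and for each $B\in\mathfrak B$ there are $U\in\mathcal U$ and $\delta>0$ with $B^{\delta}\subset U$. $\mathcal O_{\mathfrak B^s}$ is the collection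 of all $\mathfrak B^s$-covers of $X$. $X$ is $\mathfrak B^s$-Lindelöf if every $\mathfrak B^s$-cover of $X$ contains a countable subfamily that is a $\mathfrak B^s$-cover. For families $\mathfrak U,\mathfrak V$, $\mathsf S_1(\mathfrak U,\mathfrak V)$ is the statement: for each sequence $(U_n:n\in\mathbb N)$ of elements of $\mathfrak U$ there is a sequence $(u_n:n\in\mathbb N)$ with $u_n\in U_n$ for each $n$ and $\{u_n:n\in\mathbb N\}\in\mathfrak V$. For a topological space $Z$ and $z\in Z$, $\Omega_z=\{A\subset Z\setminus\{z\}: z\in\overline A\}$. $Z$ has countable strong fan tightness if $\mathsf S_1(\Omega_z,\Omega_z)$ holds for each $z\in Z$. *)

theory Defs
  imports "HOL-Analysis.Analysis"
begin

text \<open>The metric space \<open>X\<close> is a type of class \<^class>\<open>metric_space\<close>, so it is nonempty and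
  the set \<open>X\<close> itself is \<^term>\<open>UNIV\<close>.\<close>

definition bornology :: "'a::metric_space set set \<Rightarrow> bool" where
  "bornology \<BB> \<longleftrightarrow>
     {} \<notin> \<BB> \<and>
     (\<forall>\<F>. finite \<F> \<and> \<F> \<noteq> {} \<and> \<F> \<subseteq> \<BB> \<longrightarrow> \<Union>\<F> \<in> \<BB>) \<and>
     (\<forall>B\<in>\<BB>. \<forall>A. A \<subseteq> B \<and> A \<noteq> {} \<longrightarrow> A \<in> \<BB>) \<and>
     \<Union>\<BB> = UNIV"

definition bornology_base :: "'a::metric_space set set \<Rightarrow> 'a set set \<Rightarrow> bool" where
  "bornology_base \<BB>\<^sub>0 \<BB> \<longleftrightarrow> \<BB>\<^sub>0 \<subseteq> \<BB> \<and> (\<forall>B\<in>\<BB>. \<exists>B\<^sub>0\<in>\<BB>\<^sub>0. B \<subseteq> B\<^sub>0)"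

definition has_closed_base :: "'a::metric_space set set \<Rightarrow> bool" where
  "has_closed_base \<BB> \<longleftrightarrow> (\<exists>\<BB>\<^sub>0. bornology_base \<BB>\<^sub>0 \<BB> \<and> (\<forall>B\<in>\<BB>\<^sub>0. closed B))"

definition enlargement :: "'a::metric_space set \<Rightarrow> real \<Rightarrow> 'a set" where
  "enlargement A \<epsilon> = (\<Union>a\<in>A. ball a \<epsilon>)"

definition cont_funs :: "('a::metric_space \<Rightarrow> real) set" where
  "cont_funs = {f. continuous_on UNIV f}"

definition strong_nbhd :: "'a::metric_space set \<Rightarrow> real \<Rightarrow> ('a \<Rightarrow> real) \<Rightarrow> ('a \<Rightarrow> real) set" where
  "strong_nbhd B \<epsilon> f =
     {g \<in> cont_funs. \<exists>\<delta>>0. \<forall>x\<in>enlargement B \<delta>. \<bar>g x - f x\<bar> < \<epsilon>}"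

text \<open>The sets \<^term>\<open>strong_nbhd B \<epsilon> f\<close> need not be open; they form a local base of (not
  necessarily open) neighbourhoods at \<open>f\<close>, and the open sets are those containing one of them
  around each of their points. That this is a topology with the stated local bases, for a
  bornology, is proved in \<open>openin_strong_topology\<close> and \<open>strong_topology_local_base\<close>.\<close>

definition strong_topology :: "'a::metric_space set set \<Rightarrow> ('a \<Rightarrow> real) topology" where
  "strong_topology \<BB> = topology (\<lambda>W. W \<subseteq> cont_funs \<and>
     (\<forall>f\<in>W. \<exists>B\<in>\<BB>. \<exists>\<epsilon>>0. strong_nbhd B \<epsilon> f \<subseteq> W))"

definition strong_cover :: "'a::metric_space set set \<Rightarrow> 'a set set \<Rightarrow> bool" where
  "strong_cover \<BB> \<U> \<longleftrightarrow>
     (\<forall>U\<in>\<U>. open U) \<and> \<Union>\<U> = UNIV \<and> UNIV \<notin> \<U> \<and>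
     (\<forall>B\<in>\<BB>. \<exists>U\<in>\<U>. \<exists>\<delta>>0. enlargement B \<delta> \<subseteq> U)"

definition strong_covers :: "'a::metric_space set set \<Rightarrow> 'a set set set" where
  "strong_covers \<BB> = {\<U>. strong_cover \<BB> \<U>}"

definition strong_Lindelof :: "'a::metric_space set set \<Rightarrow> bool" where
  "strong_Lindelof \<BB> \<longleftrightarrow>
     (\<forall>\<U>\<in>strong_covers \<BB>. \<exists>\<V>. \<V> \<subseteq> \<U> \<and> countable \<V> \<and> \<V> \<in> strong_covers \<BB>)"

definition S1 :: "'b set set \<Rightarrow> 'b set set \<Rightarrow> bool" where
  "S1 \<UU> \<VV> \<longleftrightarrow>
     (\<forall>U :: nat \<Rightarrow> 'b set. (\<forall>n. U n \<in> \<UU>) \<longrightarrow>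
        (\<exists>u :: nat \<Rightarrow> 'b. (\<forall>n. u n \<in> U n) \<and> range u \<in> \<VV>))"

definition Omega_at :: "'b topology \<Rightarrow> 'b \<Rightarrow> 'b set set" where
  "Omega_at Z z = {A. A \<subseteq> topspace Z - {z} \<and> z \<in> Z closure_of A}"

definition countable_strong_fan_tightness :: "'b topology \<Rightarrow> bool" where
  "countable_strong_fan_tightness Z \<longleftrightarrow> (\<forall>z\<in>topspace Z. S1 (Omega_at Z z) (Omega_at Z z))"

lemma enlargement_mono: "A \<subseteq> B \<Longrightarrow> \<delta> \<le> \<delta>' \<Longrightarrow> enlargement A \<delta> \<subseteq> enlargement B \<delta>'"
  unfolding enlargement_def by force

lemma strong_nbhd_mono:
  assumes "A \<subseteq> B" "\<epsilon> \<le> \<epsilon>'"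
  shows "strong_nbhd B \<epsilon> f \<subseteq> strong_nbhd A \<epsilon>' f"
proof
  fix g assume "g \<in> strong_nbhd B \<epsilon> f"
  then obtain \<delta> where "g \<in> cont_funs" "\<delta> > 0" "\<forall>x\<in>enlargement B \<delta>. \<bar>g x - f x\<bar> < \<epsilon>"
    unfolding strong_nbhd_def by blast
  moreover have "enlargement A \<delta> \<subseteq> enlargement B \<delta>"
    using assms(1) by (intro enlargement_mono) auto
  ultimately show "g \<in> strong_nbhd A \<epsilon>' f"
    using assms(2) unfolding strong_nbhd_def by fastforce
qed

lemma strong_nbhd_self: "f \<in> cont_funs \<Longrightarrow> \<epsilon> > 0 \<Longrightarrow> f \<in> strong_nbhd B \<epsilon> f"
  unfolding strong_nbhd_def by (auto intro: exI[of _ 1])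

lemma bornology_Un:
  assumes "bornology \<BB>" "A \<in> \<BB>" "B \<in> \<BB>"
  shows "A \<union> B \<in> \<BB>"
proof -
  have "\<Union>{A, B} \<in> \<BB>"
    using assms(1)[unfolded bornology_def, THEN conjunct2, THEN conjunct1, rule_format, of "{A, B}"]
      assms(2,3) by simp
  then show ?thesis by simp
qed

lemma openin_strong_topology:
  fixes \<BB> :: "'a::metric_space set set"
  assumes "bornology \<BB>"
  shows "openin (strong_topology \<BB>) W \<longleftrightarrow>
     W \<subseteq> cont_funs \<and> (\<forall>f\<in>W. \<exists>B\<in>\<BB>. \<exists>\<epsilon>>0. strong_nbhd B \<epsilon> f \<subseteq> W)"
proof -
  let ?P = "\<lambda>W. W \<subseteq> cont_funs \<and>
     (\<forall>f\<in>W. \<exists>B\<in>\<BB>. \<exists>\<epsilon>>0. strong_nbhd B \<epsilon> f \<subseteq> W)"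
  have "istopology ?P"
    unfolding istopology_def
  proof (intro conjI allI impI)
    fix S T assume S: "?P S" and T: "?P T"
    show "S \<inter> T \<subseteq> cont_funs" using S by blast
    show "\<forall>f\<in>S \<inter> T. \<exists>B\<in>\<BB>. \<exists>\<epsilon>>0. strong_nbhd B \<epsilon> f \<subseteq> S \<inter> T"
    proof
      fix f assume f: "f \<in> S \<inter> T"
      obtain A a where A: "A \<in> \<BB>" "a > 0" "strong_nbhd A a f \<subseteq> S" using S f by blast
      obtain B b where B: "B \<in> \<BB>" "b > 0" "strong_nbhd B b f \<subseteq> T" using T f by blast
      have "strong_nbhd (A \<union> B) (min a b) f \<subseteq> strong_nbhd A a f"
           "strong_nbhd (A \<union> B) (min a b) f \<subseteq> strong_nbhd B b f"
        by (intro strong_nbhd_mono; simp)+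
      then have "strong_nbhd (A \<union> B) (min a b) f \<subseteq> S \<inter> T" using A B by blast
      moreover have "A \<union> B \<in> \<BB>" "min a b > 0" using A B bornology_Un[OF assms] by auto
      ultimately show "\<exists>B\<in>\<BB>. \<exists>\<epsilon>>0. strong_nbhd B \<epsilon> f \<subseteq> S \<inter> T" by blast
    qed
  next
    fix \<K> assume K: "\<forall>K\<in>\<K>. ?P K"
    then show "\<Union>\<K> \<subseteq> cont_funs" by blast
    show "\<forall>f\<in>\<Union>\<K>. \<exists>B\<in>\<BB>. \<exists>\<epsilon>>0. strong_nbhd B \<epsilon> f \<subseteq> \<Union>\<K>"
    proof
      fix f assume "f \<in> \<Union>\<K>"
      then obtain K where "K \<in> \<K>" "f \<in> K" by blast
      moreover from this obtain B \<epsilon> where "B \<in> \<BB>" "\<epsilon> > 0" "strong_nbhd B \<epsilon> f \<subseteq> K"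
        using K by blast
      ultimately show "\<exists>B\<in>\<BB>. \<exists>\<epsilon>>0. strong_nbhd B \<epsilon> f \<subseteq> \<Union>\<K>"
        by (intro bexI[of _ B] exI[of _ \<epsilon>]) auto
    qed
  qed
  then show ?thesis unfolding strong_topology_def by (simp add: topology_inverse')
qed

lemma topspace_strong_topology:
  fixes \<BB> :: "'a::metric_space set set"
  assumes "bornology \<BB>"
  shows "topspace (strong_topology \<BB>) = cont_funs"
proof
  show "topspace (strong_topology \<BB>) \<subseteq> cont_funs"
    using openin_strong_topology[OF assms] openin_topspace by blast
  obtain B where B: "B \<in> \<BB>" using assms unfolding bornology_def by blast
  have "openin (strong_topology \<BB>) cont_funs"
    unfolding openin_strong_topology[OF assms]
  proof (intro conjI ballI)
    fix f :: "'a \<Rightarrow> real"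
    have "strong_nbhd B 1 f \<subseteq> cont_funs" unfolding strong_nbhd_def by blast
    then show "\<exists>B\<in>\<BB>. \<exists>\<epsilon>>0. strong_nbhd B \<epsilon> f \<subseteq> cont_funs"
      using B zero_less_one by blast
  qed simp
  then show "cont_funs \<subseteq> topspace (strong_topology \<BB>)" by (rule openin_subset)
qed

lemma strong_topology_local_base:
  fixes \<BB> :: "'a::metric_space set set"
  assumes born: "bornology \<BB>" and f: "f \<in> cont_funs"
  shows "(\<exists>W. openin (strong_topology \<BB>) W \<and> f \<in> W \<and> W \<subseteq> N) \<and> N \<subseteq> cont_funs \<longleftrightarrow>
         (\<exists>B\<in>\<BB>. \<exists>\<epsilon>>0. strong_nbhd B \<epsilon> f \<subseteq> N) \<and> N \<subseteq> cont_funs"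
proof safe
  fix W assume "openin (strong_topology \<BB>) W" "f \<in> W" "W \<subseteq> N"
  then show "\<exists>B\<in>\<BB>. \<exists>\<epsilon>>0. strong_nbhd B \<epsilon> f \<subseteq> N"
    unfolding openin_strong_topology[OF born] by (meson order_trans)
next
  fix B \<epsilon> assume B: "B \<in> \<BB>" and e: "(\<epsilon>::real) > 0" and N: "strong_nbhd B \<epsilon> f \<subseteq> N"
  define W where "W = (\<Union>\<eta>\<in>{0<..<\<epsilon>}. strong_nbhd B \<eta> f)"
  have "W \<subseteq> strong_nbhd B \<epsilon> f"
    unfolding W_def by (intro UN_least strong_nbhd_mono) simp_all
  moreover have "f \<in> W"
    unfolding W_def by (rule UN_I[of "\<epsilon>/2"]) (simp_all add: e strong_nbhd_self[OF f])
  moreover have "openin (strong_topology \<BB>) W"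
    unfolding openin_strong_topology[OF born]
  proof (intro conjI ballI)
    show "W \<subseteq> cont_funs" unfolding W_def strong_nbhd_def by blast
    fix g assume "g \<in> W"
    then obtain \<eta> \<delta> where g: "0 < \<eta>" "\<eta> < \<epsilon>" "\<delta> > 0"
        "\<forall>x\<in>enlargement B \<delta>. \<bar>g x - f x\<bar> < \<eta>"
      unfolding W_def strong_nbhd_def by auto
    define r where "r = (\<epsilon> - \<eta>) / 2"
    have r: "r > 0" "\<eta> + r < \<epsilon>" using g by (auto simp: r_def field_simps)
    have "strong_nbhd B r g \<subseteq> strong_nbhd B (\<eta> + r) f"
    proof
      fix h assume "h \<in> strong_nbhd B r g"
      then obtain \<delta>' where h: "h \<in> cont_funs" "\<delta>' > 0"
          "\<forall>x\<in>enlargement B \<delta>'. \<bar>h x - g x\<bar> < r"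
        unfolding strong_nbhd_def by blast
      have sub: "enlargement B (min \<delta> \<delta>') \<subseteq> enlargement B \<delta>"
           "enlargement B (min \<delta> \<delta>') \<subseteq> enlargement B \<delta>'"
        by (intro enlargement_mono; simp)+
      have "\<bar>h x - f x\<bar> < \<eta> + r" if "x \<in> enlargement B (min \<delta> \<delta>')" for x
      proof -
        have "\<bar>h x - g x\<bar> < r" "\<bar>g x - f x\<bar> < \<eta>" using that sub g(4) h(3) by blast+
        then show ?thesis by linarith
      qed
      moreover have "min \<delta> \<delta>' > 0" using g h by simp
      ultimately show "h \<in> strong_nbhd B (\<eta> + r) f"
        using h(1) unfolding strong_nbhd_def by blast
    qed
    also have "\<dots> \<subseteq> W" unfolding W_def by (rule UN_upper) (use r g in simp)
    finally show "\<exists>B\<in>\<BB>. \<exists>\<epsilon>>0. strong_nbhd B \<epsilon> g \<subseteq> W" using B r by blast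
  qed
  ultimately show "\<exists>W. openin (strong_topology \<BB>) W \<and> f \<in> W \<and> W \<subseteq> N" using N by blast
qed

end

theory Submission
  imports Defs
begin

text \<open>Two translations between functions and open sets drive the proof. A set \<open>U\<close> containing
  \<open>B\<^sup>\<delta>\<close> is turned into a continuous function vanishing near \<open>B\<close> and equal to 1 off \<open>U\<close>, so that
  functions accumulating at 0 yield strong covers. Conversely \<open>g\<close> close to \<open>f\<close> is turned into
  \<open>{x. \<bar>g x - f x\<bar> < 1 / (n + 1)}\<close>. A strong cover swallows each \<open>B\<close> infinitely often, because one
  may add to \<open>B\<close> a point outside each of finitely many members; hence the selected
  functions come arbitrarily close to \<open>f\<close> near \<open>B\<close>. The sets that equal \<open>X\<close> must be treated
  separately: if they occur for infinitely many \<open>n\<close>, the functions giving rise to them converge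
  uniformly to \<open>f\<close>.\<close>

lemma bornology_nonempty: "bornology \<BB> \<Longrightarrow> B \<in> \<BB> \<Longrightarrow> B \<noteq> {}"
  unfolding bornology_def by blast

text \<open>Singletons belong to \<open>\<BB>\<close>, which covers the space and is closed under
  nonempty subsets. Hence a test set may be enlarged by prescribed points.\<close>

lemma bornology_Un_finite:
  assumes born: "bornology \<BB>" and B: "B \<in> \<BB>" and "finite F"
  shows "B \<union> F \<in> \<BB>"
  using \<open>finite F\<close>
proof induction
  case empty
  then show ?case using B by simp
next
  case (insert x F)
  obtain C where "C \<in> \<BB>" "x \<in> C" using born unfolding bornology_def by blast
  then have "{x} \<in> \<BB>" using born unfolding bornology_def by blast
  then have "(B \<union> F) \<union> {x} \<in> \<BB>" using bornology_Un[OF born insert.IH] by blast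
  then show ?case by simp
qed

lemma subset_enlargement: "\<delta> > 0 \<Longrightarrow> B \<subseteq> enlargement B \<delta>"
  unfolding enlargement_def by force

text \<open>Every point lies in some \<open>B \<in> \<BB>\<close>, and \<open>B\<close> lies in each
  of its enlargements, so the points are covered as soon as the sets \<open>B\<close> are.\<close>

lemma strong_coverI:
  assumes born: "bornology \<BB>"
    and "\<And>U. U \<in> \<U> \<Longrightarrow> open U" "UNIV \<notin> \<U>"
    and sub: "\<And>B. B \<in> \<BB> \<Longrightarrow> \<exists>U\<in>\<U>. \<exists>\<delta>>0. enlargement B \<delta> \<subseteq> U"
  shows "strong_cover \<BB> \<U>"
proof -
  have "x \<in> \<Union>\<U>" for x
  proof -
    obtain B where "B \<in> \<BB>" "x \<in> B" using born unfolding bornology_def by blast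
    then show ?thesis using sub[of B] subset_enlargement[of _ B] by blast
  qed
  then show ?thesis using assms unfolding strong_cover_def by blast
qed

lemma strong_cover_missing_point:
  assumes "strong_cover \<BB> \<U>" "U \<in> \<U>"
  shows "\<exists>x. x \<notin> U"
proof -
  have "U \<noteq> UNIV" using assms unfolding strong_cover_def by blast
  then show ?thesis by blast
qed

text \<open>A member that swallows \<open>B\<close> together with one missed point of each set in
  \<open>\<F>\<close> cannot be any of those sets. Applied to an initial segment of a sequence, this
  produces arbitrarily large indices.\<close>

lemma strong_cover_avoid_finite:
  assumes born: "bornology \<BB>" and cov: "strong_cover \<BB> \<U>" and B: "B \<in> \<BB>"
    and fin: "finite \<F>" and sub: "\<F> \<subseteq> \<U>"
  shows "\<exists>U\<in>\<U> - \<F>. \<exists>\<delta>>0. enlargement B \<delta> \<subseteq> U"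
proof -
  have "\<exists>x. x \<notin> U" if "U \<in> \<F>" for U
    using that sub strong_cover_missing_point[OF cov] by blast
  then obtain p where p: "\<And>U. U \<in> \<F> \<Longrightarrow> p U \<notin> U" by metis
  have "B \<union> p ` \<F> \<in> \<BB>" using bornology_Un_finite[OF born B] fin by simp
  then obtain U \<delta> where U: "U \<in> \<U>" "\<delta> > 0" "enlargement (B \<union> p ` \<F>) \<delta> \<subseteq> U"
    using cov unfolding strong_cover_def by meson
  have "enlargement B \<delta> \<subseteq> enlargement (B \<union> p ` \<F>) \<delta>"
    by (intro enlargement_mono) auto
  moreover have "U \<notin> \<F>"
    using p U(3) subset_enlargement[OF U(2), of "B \<union> p ` \<F>"] by blast
  ultimately show ?thesis using U by blast
qed

text \<open>Basic neighbourhoods need not be open, so the forward direction first finds an open set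
  inside one; the converse reads off the description of open sets.\<close>

lemma in_closure_of_strong_topology:
  fixes \<BB> :: "'a::metric_space set set"
  assumes born: "bornology \<BB>" and f: "f \<in> cont_funs"
  shows "f \<in> strong_topology \<BB> closure_of A \<longleftrightarrow>
    (\<forall>B\<in>\<BB>. \<forall>\<epsilon>>0. \<exists>g\<in>A. g \<in> strong_nbhd B \<epsilon> f)"
proof
  assume cl: "f \<in> strong_topology \<BB> closure_of A"
  show "\<forall>B\<in>\<BB>. \<forall>\<epsilon>>0. \<exists>g\<in>A. g \<in> strong_nbhd B \<epsilon> f"
  proof (intro ballI allI impI)
    fix B and \<epsilon> :: real assume "B \<in> \<BB>" "\<epsilon> > 0"
    then have "\<exists>W. openin (strong_topology \<BB>) W \<and> f \<in> W \<and> W \<subseteq> strong_nbhd B \<epsilon> f"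
      using strong_topology_local_base[OF born f, of "strong_nbhd B \<epsilon> f"]
      unfolding strong_nbhd_def by blast
    then show "\<exists>g\<in>A. g \<in> strong_nbhd B \<epsilon> f"
      using cl unfolding in_closure_of by blast
  qed
next
  assume "\<forall>B\<in>\<BB>. \<forall>\<epsilon>>0. \<exists>g\<in>A. g \<in> strong_nbhd B \<epsilon> f"
  then show "f \<in> strong_topology \<BB> closure_of A"
    unfolding in_closure_of topspace_strong_topology[OF born] openin_strong_topology[OF born]
    using f by blast
qed

lemma Omega_at_strong_topology_iff:
  fixes \<BB> :: "'a::metric_space set set"
  assumes "bornology \<BB>" "f \<in> cont_funs"
  shows "A \<in> Omega_at (strong_topology \<BB>) f \<longleftrightarrow>
    A \<subseteq> cont_funs - {f} \<and> (\<forall>B\<in>\<BB>. \<forall>\<epsilon>>0. \<exists>g\<in>A. g \<in> strong_nbhd B \<epsilon> f)"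
  unfolding Omega_at_def
  using in_closure_of_strong_topology[OF assms] topspace_strong_topology[OF assms(1)] by simp

text \<open>A rescaled distance to \<open>B\<close>, clamped to [0,1]: it is 0 where the distance is
  below \<delta>/2 and 1 where it is at least \<delta>. Vanishing on a whole enlargement is what
  membership in \<open>strong_nbhd\<close> demands.\<close>

lemma separating_function:
  fixes B :: "'a::metric_space set"
  assumes "B \<noteq> {}" "\<delta> > 0" and sub: "enlargement B \<delta> \<subseteq> U"
  obtains f :: "'a \<Rightarrow> real" where "continuous_on UNIV f"
    "\<And>x. x \<in> enlargement B (\<delta> / 2) \<Longrightarrow> f x = 0" "\<And>x. x \<notin> U \<Longrightarrow> f x = 1"
proof
  let ?f = "\<lambda>x. min 1 (max 0 (2 * infdist x B / \<delta> - 1))"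
  show "continuous_on UNIV ?f"
    by (intro continuous_intros) (use assms in auto)
  show "?f x = 0" if x: "x \<in> enlargement B (\<delta> / 2)" for x
  proof -
    obtain a where "a \<in> B" "dist a x < \<delta> / 2"
      using x unfolding enlargement_def by auto
    then have "infdist x B < \<delta> / 2" using infdist_le[of a B x] by (simp add: dist_commute)
    then show ?thesis using assms by (simp add: field_simps)
  qed
  show "?f x = 1" if x: "x \<notin> U" for x
  proof -
    have "\<delta> \<le> dist x a" if "a \<in> B" for a
      using x sub that unfolding enlargement_def by (force simp: dist_commute)
    then have "\<delta> \<le> infdist x B"
      using assms unfolding infdist_def by (auto intro: cINF_greatest)
    then show ?thesis using assms by (simp add: field_simps)
  qed
qed

lemma S1_strong_covers_if_fan_tightness:
  fixes \<BB> :: "'a::metric_space set set"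
  assumes born: "bornology \<BB>"
    and fan: "countable_strong_fan_tightness (strong_topology \<BB>)"
  shows "S1 (strong_covers \<BB>) (strong_covers \<BB>)"
  unfolding S1_def
proof (intro allI impI)
  fix \<U> :: "nat \<Rightarrow> 'a set set" assume "\<forall>n. \<U> n \<in> strong_covers \<BB>"
  then have cov: "strong_cover \<BB> (\<U> n)" for n unfolding strong_covers_def by simp
  have zero: "(\<lambda>_. 0) \<in> (cont_funs :: ('a \<Rightarrow> real) set)" unfolding cont_funs_def by simp
  define A where "A n = {f :: 'a \<Rightarrow> real. f \<in> cont_funs \<and> (\<exists>U\<in>\<U> n. \<forall>x. x \<notin> U \<longrightarrow> f x = 1)}" for n
  have "A n \<in> Omega_at (strong_topology \<BB>) (\<lambda>_. 0)" for n
    unfolding Omega_at_strong_topology_iff[OF born zero]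
  proof (intro conjI ballI allI impI)
    have "(\<lambda>_. 0) \<notin> A n"
    proof
      assume "(\<lambda>_. 0) \<in> A n"
      then obtain U where "U \<in> \<U> n" "\<forall>x. x \<notin> U \<longrightarrow> (0::real) = 1" unfolding A_def by blast
      \<comment> \<open>Since \<open>UNIV\<close> is not in the cover, some point lies off
        \<open>U\<close>, and there 0 would have to equal 1.\<close>
      then show False using strong_cover_missing_point[OF cov[of n], of U] by auto
    qed
    then show "A n \<subseteq> cont_funs - {\<lambda>_. 0}" unfolding A_def by blast
    fix B and \<epsilon> :: real assume B: "B \<in> \<BB>" and e: "\<epsilon> > 0"
    obtain U \<delta> where U: "U \<in> \<U> n" "\<delta> > 0" "enlargement B \<delta> \<subseteq> U"
      using cov[of n] B unfolding strong_cover_def by meson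
    obtain f :: "'a \<Rightarrow> real" where f: "continuous_on UNIV f"
      "\<And>x. x \<in> enlargement B (\<delta> / 2) \<Longrightarrow> f x = 0" "\<And>x. x \<notin> U \<Longrightarrow> f x = 1"
      using separating_function[OF bornology_nonempty[OF born B] U(2,3)] by blast
    have "f \<in> A n" using f U(1) unfolding A_def cont_funs_def by blast
    moreover have "f \<in> strong_nbhd B \<epsilon> (\<lambda>_. 0)"
      unfolding strong_nbhd_def cont_funs_def using f U(2) e by (auto intro!: exI[of _ "\<delta> / 2"])
    ultimately show "\<exists>g\<in>A n. g \<in> strong_nbhd B \<epsilon> (\<lambda>_. 0)" by blast
  qed
  then obtain f where f: "\<And>n. f n \<in> A n"
    and ran: "range f \<in> Omega_at (strong_topology \<BB>) (\<lambda>_. 0)"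
    using fan zero
    unfolding countable_strong_fan_tightness_def S1_def topspace_strong_topology[OF born]
    by meson
  have "\<exists>U\<in>\<U> n. \<forall>x. x \<notin> U \<longrightarrow> f n x = 1" for n using f[of n] unfolding A_def by blast
  then obtain u where u: "\<And>n. u n \<in> \<U> n" "\<And>n x. x \<notin> u n \<Longrightarrow> f n x = 1" by metis
  have "strong_cover \<BB> (range u)"
  proof (rule strong_coverI[OF born])
    show "open U" if "U \<in> range u" for U
      using that u(1) cov unfolding strong_cover_def by blast
    show "UNIV \<notin> range u"
      using u(1) cov unfolding strong_cover_def by (metis imageE)
    fix B assume "B \<in> \<BB>"
    \<comment> \<open>The radius 1 matches the value taken off \<open>u n\<close>: wherever
      \<open>f n\<close> is smaller than 1 in absolute value, the point must lie in
      \<open>u n\<close>.\<close>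
    then obtain n where "f n \<in> strong_nbhd B 1 (\<lambda>_. 0)"
      using ran unfolding Omega_at_strong_topology_iff[OF born zero] by (metis imageE zero_less_one)
    then obtain \<delta> where d: "\<delta> > 0" "\<forall>x\<in>enlargement B \<delta>. \<bar>f n x - 0\<bar> < 1"
      unfolding strong_nbhd_def by blast
    then have "enlargement B \<delta> \<subseteq> u n" using u(2)[of _ n] by force
    then show "\<exists>U\<in>range u. \<exists>\<delta>>0. enlargement B \<delta> \<subseteq> U" using d(1) by blast
  qed
  then show "\<exists>u. (\<forall>n. u n \<in> \<U> n) \<and> range u \<in> strong_covers \<BB>"
    using u(1) unfolding strong_covers_def by blast
qed

lemma fan_tightness_if_S1_strong_covers:
  fixes \<BB> :: "'a::metric_space set set"
  assumes born: "bornology \<BB>"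
    and sel: "S1 (strong_covers \<BB>) (strong_covers \<BB>)"
  shows "countable_strong_fan_tightness (strong_topology \<BB>)"
  unfolding countable_strong_fan_tightness_def S1_def topspace_strong_topology[OF born]
proof (intro ballI allI impI)
  fix f :: "'a \<Rightarrow> real" and A :: "nat \<Rightarrow> ('a \<Rightarrow> real) set"
  assume f: "f \<in> cont_funs" and "\<forall>n. A n \<in> Omega_at (strong_topology \<BB>) f"
  then have A: "A n \<subseteq> cont_funs - {f}"
    and near: "B \<in> \<BB> \<Longrightarrow> \<epsilon> > 0 \<Longrightarrow> \<exists>g\<in>A n. g \<in> strong_nbhd B \<epsilon> f" for n B \<epsilon>
    using Omega_at_strong_topology_iff[OF born f] by blast+
  \<comment> \<open>The threshold shrinks with \<open>n\<close>, so hits at arbitrarily large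
    indices serve every \<epsilon>. \<open>Suc\<close> keeps it positive at
    \<open>n = 0\<close>.\<close>
  define V where "V n g = {x. \<bar>g x - f x\<bar> < 1 / real (Suc n)}" for n and g :: "'a \<Rightarrow> real"
  obtain B\<^sub>0 where "B\<^sub>0 \<in> \<BB>" using born unfolding bornology_def by blast
  then have "A n \<noteq> {}" for n using near[of B\<^sub>0 1] by (metis empty_iff zero_less_one)
  then have "\<exists>g. g \<in> A n" for n by blast
  \<comment> \<open>Default choices, for indices at which any member of \<open>A n\<close> will
    do.\<close>
  then obtain h where h: "\<And>n. h n \<in> A n" by metis
  \<comment> \<open>The common end of both cases: it suffices that each \<open>B\<close> is strongly
    contained in \<open>V n (g n)\<close> for infinitely many \<open>n\<close>.\<close>
  have reduce: "\<exists>g. (\<forall>n. g n \<in> A n) \<and> range g \<in> Omega_at (strong_topology \<BB>) f"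
    if g: "\<And>n. g n \<in> A n"
      and often: "\<And>B k. B \<in> \<BB> \<Longrightarrow> \<exists>n\<ge>k. \<exists>\<delta>>0. enlargement B \<delta> \<subseteq> V n (g n)" for g
  proof (intro exI conjI allI)
    show "g n \<in> A n" for n by (rule g)
    show "range g \<in> Omega_at (strong_topology \<BB>) f"
      unfolding Omega_at_strong_topology_iff[OF born f]
    proof (intro conjI ballI allI impI)
      show "range g \<subseteq> cont_funs - {f}" using g A by blast
      fix B and \<epsilon> :: real assume B: "B \<in> \<BB>" and e: "\<epsilon> > 0"
      obtain k where k: "1 / real (Suc k) < \<epsilon>" using nat_approx_posE[OF e] by blast
      obtain n \<delta> where n: "n \<ge> k" "\<delta> > 0" "enlargement B \<delta> \<subseteq> V n (g n)"
        using often[OF B, of k] by blast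
      have "1 / real (Suc n) \<le> 1 / real (Suc k)" using n(1) by (simp add: field_simps)
      then have "\<forall>x\<in>enlargement B \<delta>. \<bar>g n x - f x\<bar> < \<epsilon>"
        using n(3) k unfolding V_def by force
      then have "g n \<in> strong_nbhd B \<epsilon> f"
        using n(2) g[of n] A unfolding strong_nbhd_def by blast
      then show "\<exists>h\<in>range g. h \<in> strong_nbhd B \<epsilon> f" by blast
    qed
  qed
  let ?full = "\<lambda>n. \<exists>g\<in>A n. V n g = UNIV"
  show "\<exists>g. (\<forall>n. g n \<in> A n) \<and> range g \<in> Omega_at (strong_topology \<BB>) f"
  proof (cases "\<exists>N. \<forall>n\<ge>N. \<not> ?full n")
    case False
    have "\<exists>g. g \<in> A n \<and> (?full n \<longrightarrow> V n g = UNIV)" for n using h by blast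
    then obtain g where g: "\<And>n. g n \<in> A n" "\<And>n. ?full n \<Longrightarrow> V n (g n) = UNIV" by metis
    show ?thesis
    proof (rule reduce[of g, OF g(1)])
      fix B :: "'a set" and k
      obtain n where "n \<ge> k" "?full n" using False by blast
      then show "\<exists>n\<ge>k. \<exists>\<delta>>0. enlargement B \<delta> \<subseteq> V n (g n)"
        using g(2)[of n] zero_less_one[where 'a=real] by blast
    qed
  next
    case True
    then obtain N where N: "\<And>n. n \<ge> N \<Longrightarrow> \<not> ?full n" by blast
    \<comment> \<open>From \<open>N\<close> on no \<open>V n g\<close> is the whole space, so the
      shifted families omit \<open>UNIV\<close> and the selection principle applies to them.\<close>
    have "strong_cover \<BB> (V (N + n) ` A (N + n))" for n
    proof (rule strong_coverI[OF born])
      show "open U" if "U \<in> V (N + n) ` A (N + n)" for U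
      proof -
        obtain g where g: "g \<in> A (N + n)" "U = V (N + n) g" using \<open>U \<in> _\<close> by blast
        then have "continuous_on UNIV g" "continuous_on UNIV f"
          using A f unfolding cont_funs_def by blast+
        then show ?thesis unfolding g(2) V_def
          by (intro open_Collect_less continuous_intros)
      qed
      show "UNIV \<notin> V (N + n) ` A (N + n)" using N[of "N + n"] by auto
      fix B assume "B \<in> \<BB>"
      then obtain g where g: "g \<in> A (N + n)" "g \<in> strong_nbhd B (1 / real (Suc (N + n))) f"
        using near[of B "1 / real (Suc (N + n))" "N + n"] by (metis of_nat_0_less_iff zero_less_Suc zero_less_divide_1_iff)
      then obtain \<delta> where "\<delta> > 0" "enlargement B \<delta> \<subseteq> V (N + n) g"
        unfolding strong_nbhd_def V_def by blast
      then show "\<exists>U\<in>V (N + n) ` A (N + n). \<exists>\<delta>>0. enlargement B \<delta> \<subseteq> U"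
        using g(1) by blast
    qed
    then have "\<forall>n. V (N + n) ` A (N + n) \<in> strong_covers \<BB>" unfolding strong_covers_def by blast
    then obtain u where u: "\<And>n. u n \<in> V (N + n) ` A (N + n)" and cov: "strong_cover \<BB> (range u)"
      using sel[unfolded S1_def, rule_format, of "\<lambda>n. V (N + n) ` A (N + n)"]
      unfolding strong_covers_def by blast
    have "\<exists>g. g \<in> A (N + n) \<and> u n = V (N + n) g" for n using u[of n] by blast
    then obtain g where g: "\<And>n. g n \<in> A (N + n)" "\<And>n. u n = V (N + n) (g n)" by metis
    \<comment> \<open>Undoes the shift by \<open>N\<close>; the first \<open>N\<close> places are
      filled from \<open>h\<close>.\<close>
    define g' where "g' n = (if n < N then h n else g (n - N))" for n
    have g': "g' (N + n) = g n" for n unfolding g'_def by simp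
    show ?thesis
    proof (rule reduce[of g'])
      show "g' n \<in> A n" for n
        unfolding g'_def using h[of n] g(1)[of "n - N"] by (cases "n < N") auto
      fix B k assume "B \<in> \<BB>"
      \<comment> \<open>The sequence \<open>u\<close> may repeat sets, so the sets
        \<open>u i\<close> with \<open>i < k\<close> are avoided rather than the indices; this still
        forces \<open>n \<ge> k\<close>.\<close>
      then obtain n \<delta> where n: "u n \<notin> u ` {..<k}" "\<delta> > 0" "enlargement B \<delta> \<subseteq> u n"
        using strong_cover_avoid_finite[OF born cov, of B "u ` {..<k}"] by blast
      then have "N + n \<ge> k" by (force simp: not_less)
      moreover have "enlargement B \<delta> \<subseteq> V (N + n) (g' (N + n))" using n(3) by (simp add: g(2) g')
      ultimately show "\<exists>n\<ge>k. \<exists>\<delta>>0. enlargement B \<delta> \<subseteq> V n (g' n)"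
        using n(2) by blast
    qed
  qed
qed

theorem theorem2p2:
  fixes \<BB> :: "'a::metric_space set set"
  assumes "bornology \<BB>"
    and "has_closed_base \<BB>"
    and "UNIV \<notin> \<BB>"
    and "strong_Lindelof \<BB>"
  shows "countable_strong_fan_tightness (strong_topology \<BB>) \<longleftrightarrow>
         S1 (strong_covers \<BB>) (strong_covers \<BB>)"
  using S1_strong_covers_if_fan_tightness[OF assms(1)]
    fan_tightness_if_S1_strong_covers[OF assms(1)] by blast

end
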